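(* Assume that $u>0$ is a positive solution of the equation $\Delta u=1$ in $\mathbf{R}^n$. Then $u$ is a polynomial of the form $$a_0+\sum_{j=1}^n a_jx_j^2,$$ where $a_0>0$, $a_j\ge 0$ for $j=1,\dots,n$, and $2\sum_{j=1}^n a_j=1$.
   Formalization: The form holds only after a rigid change of Cartesian coordinates (orthogonal map and choice of origin); in the given coordinates it fails, e.g. u = x²/2 + x + 1 on R. "Solution" is taken to mean a C² solution. *)

theory Defs
  imports "HOL-Analysis.Analysis"
begin

text \<open>Meaningful only where the partial derivative exists, since \<^const>\<open>deriv\<close> is total.\<close>
definition partial_deriv :: "'n::finite \<Rightarrow> (real ^ 'n \<Rightarrow> real) \<Rightarrow> real ^ 'n \<Rightarrow> real"
  where "partial_deriv i f x = deriv (\<lambda>t. f (x + t *\<^sub>R axis i 1)) 0"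

definition C1 :: "(real ^ 'n::finite \<Rightarrow> real) \<Rightarrow> bool"
  where "C1 f \<longleftrightarrow> (\<forall>i.
    (\<forall>x. (\<lambda>t. f (x + t *\<^sub>R axis i 1)) differentiable (at (0::real))) \<and>
    continuous_on UNIV (partial_deriv i f))"

definition C2 :: "(real ^ 'n::finite \<Rightarrow> real) \<Rightarrow> bool"
  where "C2 f \<longleftrightarrow> C1 f \<and> (\<forall>i. C1 (partial_deriv i f))"

definition laplacian :: "(real ^ 'n::finite \<Rightarrow> real) \<Rightarrow> real ^ 'n \<Rightarrow> real"
  where "laplacian f x = (\<Sum>i\<in>UNIV. partial_deriv i (partial_deriv i f) x)"

end

theory Submission
  imports Defs
begin

text \<open>
  The argument is the classical proof of Liouville's theorem, with averages against the kernel
  \<^term>\<open>max 0 (r\<^sup>2 - (norm (z - x))\<^sup>2)\<close> in place of averages over balls. As a function of \<open>y\<close>, the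
  vector field \<open>y * max 0 (1 - norm(y)^2)\<close> is a gradient of a compactly supported \<open>C\<^sup>1\<close>
  function, so differentiating the average of \<open>u (x + r y)\<close> in \<open>r\<close> and integrating by parts once
  turns the derivative into an average of the Laplacian. A function with constant Laplacian hence
  satisfies the mean value identity up to an explicit multiple of \<open>r\<^sup>2\<close>
  (\<open>quadratic_mean_value_of_laplacian\<close>).

  Everything analytic now follows from the identity. Positivity of \<open>u\<close> lets averages around \<open>x\<close> be
  compared with averages of four times the radius around \<open>0\<close>, which gives \<open>u = O((1 + norm x)\<^sup>2)\<close>
  (\<open>quadratic_growth\<close>). Increments \<open>u (x + h) - u x\<close> satisfy the identity as well, and since the
  kernel is Lipschitz, each increment lowers the order of growth by one (\<open>increment_bound\<close>). Two
  increments bring quadratic growth down to boundedness, and a third one is then \<open>O(1 / r)\<close> for all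
  large \<open>r\<close>, so all third increments of \<open>u\<close> vanish.

  A differentiable function with vanishing third increments is a quadratic polynomial, because its
  second increments form a symmetric bi-additive, hence bilinear, map. Diagonalizing the quadratic
  part in an orthonormal basis, positivity on each coordinate axis forces the eigenvalues to be
  nonnegative and the linear coefficient to vanish wherever the eigenvalue does; completing squares
  moves the centre to a point \<open>p\<close>, where the remaining constant is \<open>u p > 0\<close>. The Laplacian is twice
  the trace, which yields the last relation.
\<close>

section \<open>A compactly supported quadratic kernel\<close>

definition bump :: "real \<Rightarrow> 'a::real_inner \<Rightarrow> real"
  where "bump r z = max 0 (r\<^sup>2 - (norm z)\<^sup>2)"

text \<open>A fixed box of integration. It is larger than the support of the kernel, so that functions
  supported in the unit ball may be translated by up to one unit without leaving it.\<close>
abbreviation box2 :: "'a::euclidean_space set"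
  where "box2 \<equiv> cbox (- 2 *\<^sub>R One) (2 *\<^sub>R One)"

lemma bump_nonneg: "0 \<le> bump r z"
  by (simp add: bump_def)

lemma bump_eq_0: "0 \<le> r \<Longrightarrow> r \<le> norm z \<Longrightarrow> bump r z = 0"
  by (simp add: bump_def power_mono)

lemma continuous_bump [continuous_intros]:
  "continuous_on S f \<Longrightarrow> continuous_on S (\<lambda>x. bump r (f x))"
  unfolding bump_def by (intro continuous_intros)

lemma bump_scale:
  assumes "r > 0"
  shows "bump r z = r\<^sup>2 * bump 1 (z /\<^sub>R r)"
proof -
  have "r\<^sup>2 * bump 1 (z /\<^sub>R r) = max (r\<^sup>2 * 0) (r\<^sup>2 * (1 - (norm z / r)\<^sup>2))"
    unfolding bump_def using assms
    by (subst max_mult_distrib_left) (simp add: divide_inverse_commute)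
  also have "r\<^sup>2 * (1 - (norm z / r)\<^sup>2) = r\<^sup>2 - (norm z)\<^sup>2"
    using assms by (simp add: field_simps)
  finally show ?thesis by (simp add: bump_def)
qed

lemma in_box2:
  fixes y :: "'a::euclidean_space"
  assumes "norm y \<le> 2"
  shows "y \<in> box2"
  using assms Basis_le_norm[of _ y] by (fastforce simp: mem_box abs_le_iff)

text \<open>The substitution \<open>z = x + r y\<close>. On the left the kernel carries the dependence on \<open>x\<close>, which is
  what increments in \<open>x\<close> are estimated with; on the right the function does, which is the form that
  can be differentiated in \<open>r\<close>.\<close>
lemma has_integral_rescale:
  fixes w :: "'a::euclidean_space \<Rightarrow> real"
  assumes "continuous_on UNIV w" "r > 0"
  shows "((\<lambda>z. w z * bump r (z - x)) has_integral
     r ^ (DIM('a) + 2) * integral box2 (\<lambda>y. w (x + r *\<^sub>R y) * bump 1 y)) UNIV"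
proof -
  let ?f = "\<lambda>y. w (x + r *\<^sub>R y) * bump 1 y"
  let ?I = "integral box2 ?f"
  have "continuous_on box2 ?f"
    by (intro continuous_intros continuous_on_compose2[OF assms(1)]) auto
  then have "(?f has_integral ?I) box2"
    by (intro integrable_integral integrable_continuous)
  from has_integral_affinity'[OF this, of "1 / r" "- (x /\<^sub>R r)"]
  obtain a b where ab_int: "((\<lambda>z. ?f ((1 / r) *\<^sub>R z + - (x /\<^sub>R r))) has_integral (?I /\<^sub>R (1 / r) ^ DIM('a))) (cbox a b)"
    and ab: "a = ((- 2 *\<^sub>R One) - - (x /\<^sub>R r)) /\<^sub>R (1 / r)" "b = (2 *\<^sub>R One - - (x /\<^sub>R r)) /\<^sub>R (1 / r)"
    using assms by simp
  from ab_int have "((\<lambda>z. ?f ((1 / r) *\<^sub>R z + - (x /\<^sub>R r))) has_integral (?I /\<^sub>R (1 / r) ^ DIM('a))) UNIV"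
  proof (rule has_integral_on_superset)
    fix z assume z: "z \<notin> cbox a b"
    let ?y = "(1 / r) *\<^sub>R z + - (x /\<^sub>R r)"
    have "?y \<notin> box2"
    proof
      assume "?y \<in> box2"
      then have "z \<in> cbox a b"
        using assms(2) unfolding ab mem_box
        by (auto simp: inner_simps field_simps)
      with z show False ..
    qed
    then have "norm ?y \<ge> 1" using in_box2[of ?y] by linarith
    then show "?f ?y = 0" by (simp add: bump_eq_0)
  qed simp
  then have "((\<lambda>z. r\<^sup>2 * ?f ((1 / r) *\<^sub>R z + - (x /\<^sub>R r))) has_integral r\<^sup>2 * (?I /\<^sub>R (1 / r) ^ DIM('a))) UNIV"
    by (rule has_integral_mult_right)
  moreover have "r\<^sup>2 * (?I /\<^sub>R (1 / r) ^ DIM('a)) = r ^ (DIM('a) + 2) * ?I"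
    using assms(2) by (simp add: power_add divide_inverse power_inverse power2_eq_square)
  moreover have "r\<^sup>2 * ?f ((1 / r) *\<^sub>R z + - (x /\<^sub>R r)) = w z * bump r (z - x)" for z
    using assms(2) by (simp add: bump_scale[OF assms(2)] scaleR_right_diff_distrib divide_inverse)
  ultimately show ?thesis by (simp only:)
qed

definition bump_mass :: "'a::euclidean_space itself \<Rightarrow> real"
  where "bump_mass _ = integral box2 (bump 1 :: 'a \<Rightarrow> real)"

lemma bump_mass_pos: "0 < bump_mass TYPE('a::euclidean_space)"
proof -
  let ?f = "bump 1 :: 'a \<Rightarrow> real"
  have cont: "continuous_on box2 ?f" 
    using continuous_bump[OF continuous_on_id, of box2 1] by simp
  have int: "?f integrable_on box2" by (rule integrable_continuous[OF cont])
  have "0 \<le> integral box2 ?f"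
    by (rule integral_nonneg[OF int]) (simp add: bump_nonneg)
  moreover have "integral box2 ?f \<noteq> 0"
  proof
    assume "integral box2 ?f = 0"
    then have "(?f has_integral 0) box2" using int by (simp add: has_integral_iff)
    moreover have "box (- 2 *\<^sub>R One) (2 *\<^sub>R One :: 'a) \<noteq> {}" by (simp add: box_ne_empty)
    ultimately have "?f 0 = 0"
      using has_integral_0_cbox_imp_0[OF cont, of 0] bump_nonneg in_box2[of 0] by fastforce
    then show False by (simp add: bump_def)
  qed
  ultimately show ?thesis by (simp add: bump_mass_def)
qed

text \<open>For \<open>d = 0\<close> this is the mean value property of harmonic functions.\<close>
definition quadratic_mean_value :: "real \<Rightarrow> ('a::euclidean_space \<Rightarrow> real) \<Rightarrow> bool"
  where "quadratic_mean_value d w \<longleftrightarrow> continuous_on UNIV w \<and>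
    (\<forall>x r. r > 0 \<longrightarrow>
      integral box2 (\<lambda>y. w (x + r *\<^sub>R y) * bump 1 y) = bump_mass TYPE('a) * w x + d * r\<^sup>2)"

text \<open>Only the total mass of the kernel is encoded here; it is used to evaluate the integrals of \<open>bump r\<close>.\<close>
lemma quadratic_mean_value_1: "quadratic_mean_value 0 (\<lambda>x::'a::euclidean_space. 1)"
  by (simp add: quadratic_mean_value_def bump_mass_def)

lemma quadratic_mean_valueD:
  fixes w :: "'a::euclidean_space \<Rightarrow> real"
  assumes "quadratic_mean_value d w" "r > 0"
  shows "((\<lambda>z. w z * bump r (z - x)) has_integral
       r ^ (DIM('a) + 2) * (bump_mass TYPE('a) * w x + d * r\<^sup>2)) UNIV"
  using has_integral_rescale[of w r x] assms by (auto simp: quadratic_mean_value_def)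


section \<open>Functions with continuous partial derivatives\<close>

lemma has_partial_deriv:
  fixes f :: "real ^ 'n::finite \<Rightarrow> real"
  assumes "C1 f"
  shows "((\<lambda>t. f (x + t *\<^sub>R axis i 1)) has_real_derivative partial_deriv i f (x + s *\<^sub>R axis i 1)) (at s)"
proof -
  have "(\<lambda>t. f ((x + s *\<^sub>R axis i 1) + t *\<^sub>R axis i 1)) differentiable (at (0::real))"
    using assms by (simp add: C1_def)
  then have "((\<lambda>t. f ((x + s *\<^sub>R axis i 1) + t *\<^sub>R axis i 1)) has_real_derivative partial_deriv i f (x + s *\<^sub>R axis i 1)) (at 0)"
    unfolding partial_deriv_def
    by (meson DERIV_deriv_iff_real_differentiable)
  then have "((\<lambda>t. f (x + (s + t) *\<^sub>R axis i 1)) has_real_derivative partial_deriv i f (x + s *\<^sub>R axis i 1)) (at 0)"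
    by (simp add: scaleR_add_left add.assoc)
  then show ?thesis
    using DERIV_at_within_shift[of "\<lambda>t. f (x + t *\<^sub>R axis i 1)" _ s 0 UNIV] by (simp add: add.commute)
qed

lemma continuous_partial_deriv:
  "C1 f \<Longrightarrow> continuous_on UNIV (partial_deriv i f)"
  by (simp add: C1_def)

text \<open>Continuity of the partial derivatives gives total differentiability by moving one coordinate
  at a time; the induction adds a coordinate \<open>j\<close> to those already moved.\<close>
lemma has_derivative_coordinates:
  fixes f :: "real ^ 'n::finite \<Rightarrow> real"
  assumes "C1 f"
  shows "((\<lambda>h. f (x + (\<Sum>i\<in>I. (h $ i) *\<^sub>R axis i 1))) has_derivative (\<lambda>h. \<Sum>i\<in>I. partial_deriv i f x * h $ i)) (at 0)"
proof (induction I rule: finite_induct[OF finite])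
  case 1
  show ?case by simp
next
  case (2 j I)
  let ?P = "\<lambda>h::real^'n. \<Sum>i\<in>I. (h $ i) *\<^sub>R axis i (1::real)"
  let ?g = "\<lambda>h. f (x + ?P h + (h $ j) *\<^sub>R axis j 1) - f (x + ?P h)"
  have "(?g has_derivative (\<lambda>h. partial_deriv j f x * h $ j)) (at 0)"
    unfolding has_derivative_at_alt
  proof (intro conjI allI impI)
    show "bounded_linear (\<lambda>h::real^'n. partial_deriv j f x * h $ j)"
      by (intro bounded_linear_intros bounded_linear_vec_nth)
    fix e :: real assume "e > 0"
    have "isCont (partial_deriv j f) x"
      using continuous_partial_deriv[OF assms] by (simp add: continuous_on_eq_continuous_at)
    then obtain d where d: "d > 0" "\<And>y. dist y x < d \<Longrightarrow> dist (partial_deriv j f y) (partial_deriv j f x) < e"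
      using \<open>e > 0\<close> unfolding continuous_at_eps_delta by blast
    (* norm h < d / m keeps every intermediate point, at most CARD('n) + 1 steps of length
       norm h away from x, inside the ball of radius d. *)
    define m where "m = real CARD('n) + 1"
    have m: "m > 0" by (simp add: m_def)
    show "\<exists>d>0. \<forall>h. norm (h - 0) < d \<longrightarrow> norm (?g h - ?g 0 - partial_deriv j f x * (h - 0) $ j) \<le> e * norm (h - 0)"
    proof (intro exI[of _ "d / m"] conjI allI impI)
      show "d / m > 0" using d m by simp
      fix h :: "real^'n" assume h: "norm (h - 0) < d / m"
      have near: "dist (x + ?P h + t *\<^sub>R axis j 1) x < d" if "\<bar>t\<bar> \<le> \<bar>h $ j\<bar>" for t
      proof -
        have "norm (?P h) \<le> (\<Sum>i\<in>I. norm h)"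
          by (intro sum_norm_le) (simp add: norm_axis_1 component_le_norm_cart)
        also have "\<dots> \<le> real CARD('n) * norm h"
          by (simp add: card_mono mult_right_mono)
        finally have "norm (?P h) \<le> real CARD('n) * norm h" .
        moreover have "norm (t *\<^sub>R axis j (1::real) :: real^'n) \<le> norm h"
          using that component_le_norm_cart[of h j] by simp
        ultimately have "norm (?P h + t *\<^sub>R axis j 1) \<le> m * norm h"
          using norm_triangle_ineq[of "?P h" "t *\<^sub>R axis j 1"] unfolding m_def distrib_right by linarith
        also have "\<dots> < d" using h m by (simp add: field_simps)
        finally show ?thesis by (simp add: dist_norm add.assoc)
      qed
      (* The mean value inequality for the last step, with its expected linear part removed. *)
      let ?\<phi> = "\<lambda>t. f (x + ?P h + t *\<^sub>R axis j 1) - partial_deriv j f x * t"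
      have "norm (?\<phi> (h $ j) - ?\<phi> 0) \<le> e * norm (h $ j - 0)"
      proof (rule field_differentiable_bound[where S = "cball 0 \<bar>h $ j\<bar>"])
        fix t assume "t \<in> cball (0::real) \<bar>h $ j\<bar>"
        then have t: "\<bar>t\<bar> \<le> \<bar>h $ j\<bar>" by (simp add: dist_real_def)
        show "(?\<phi> has_field_derivative (partial_deriv j f (x + ?P h + t *\<^sub>R axis j 1) - partial_deriv j f x))
            (at t within cball 0 \<bar>h $ j\<bar>)"
          by (rule has_field_derivative_at_within)
            (auto intro!: derivative_eq_intros has_partial_deriv[OF assms])
        show "norm (partial_deriv j f (x + ?P h + t *\<^sub>R axis j 1) - partial_deriv j f x) \<le> e"
          using d(2)[OF near[OF t]] by (simp add: dist_norm)
      qed auto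
      then have "norm (?g h - partial_deriv j f x * h $ j) \<le> e * \<bar>h $ j\<bar>"
        by (simp add: algebra_simps)
      also have "\<dots> \<le> e * norm h"
        using \<open>e > 0\<close> by (intro mult_left_mono component_le_norm_cart) auto
      finally show "norm (?g h - ?g 0 - partial_deriv j f x * (h - 0) $ j) \<le> e * norm (h - 0)" by simp
    qed
  qed
  from has_derivative_add[OF 2(3) this] show ?case
    using 2(1,2) by (simp add: add_ac)
qed

lemma C1_has_derivative:
  fixes f :: "real ^ 'n::finite \<Rightarrow> real"
  assumes "C1 f"
  shows "(f has_derivative (\<lambda>h. \<Sum>i\<in>UNIV. partial_deriv i f x * h $ i)) (at x)"
proof -
  have *: "(\<Sum>i\<in>UNIV. (h $ i) *\<^sub>R axis i 1) = h" for h :: "real^'n"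
    using basis_expansion[of h] by (simp add: scalar_mult_eq_scaleR)
  show ?thesis
    using has_derivative_coordinates[OF assms, of x UNIV]
    unfolding * has_derivative_at by (simp add: add.commute)
qed

lemma C1_continuous:
  fixes f :: "real ^ 'n::finite \<Rightarrow> real"
  assumes "C1 f"
  shows "continuous_on UNIV f"
  using has_derivative_continuous[OF C1_has_derivative[OF assms]]
  by (simp add: continuous_on_eq_continuous_at)

text \<open>Integration by parts without boundary terms. Translating \<open>g\<close> along \<open>e\<close> does not change its
  integral as long as the support stays in the box, so the derivative of the integral along the
  translation is zero.\<close>
lemma integral_directional_derivative_eq_0:
  fixes g :: "'a::euclidean_space \<Rightarrow> real"
  assumes cont: "continuous_on UNIV g" "continuous_on UNIV g'"
    and deriv: "\<And>x t. ((\<lambda>t. g (x + t *\<^sub>R e)) has_real_derivative g' (x + t *\<^sub>R e)) (at t)"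
    and supp: "\<And>x. norm x \<ge> 1 \<Longrightarrow> g x = 0" and e: "norm e = 1"
  shows "integral box2 g' = 0"
proof -
  let ?U = "{-1<..<1::real}"
  have const: "integral box2 (\<lambda>y. g (y + t *\<^sub>R e)) = integral box2 g" if "t \<in> ?U" for t
  proof -
    have "((\<lambda>y. g (y + t *\<^sub>R e)) has_integral integral box2 (\<lambda>y. g (y + t *\<^sub>R e))) box2"
      by (intro integrable_integral integrable_continuous continuous_on_compose2[OF cont(1)] continuous_intros) auto
    then have "((\<lambda>y. g (y + t *\<^sub>R e)) has_integral integral box2 (\<lambda>y. g (y + t *\<^sub>R e))) UNIV"
    proof (rule has_integral_on_superset)
      fix y :: 'a assume "y \<notin> box2"
      then have "norm y > 2" using in_box2[of y] by linarith
      then have "norm (y + t *\<^sub>R e) \<ge> 1"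
        using norm_diff_ineq[of y "t *\<^sub>R e"] that e by (simp add: abs_if split: if_splits)
      then show "g (y + t *\<^sub>R e) = 0" by (rule supp)
    qed simp
    moreover have "((\<lambda>y. g (y + t *\<^sub>R e)) has_integral integral box2 g) UNIV"
    proof (rule has_integral_on_superset)
      have "(g has_integral integral box2 g) box2"
        by (intro integrable_integral integrable_continuous continuous_on_subset[OF cont(1)]) auto
      from has_integral_affinity'[OF this, of 1 "t *\<^sub>R e"]
      show "((\<lambda>y. g (y + t *\<^sub>R e)) has_integral integral box2 g)
          (cbox (- 2 *\<^sub>R One - t *\<^sub>R e) (2 *\<^sub>R One - t *\<^sub>R e))"
        by simp
      fix y :: 'a assume "y \<notin> cbox (- 2 *\<^sub>R One - t *\<^sub>R e) (2 *\<^sub>R One - t *\<^sub>R e)"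
      then have "y + t *\<^sub>R e \<notin> box2" by (auto simp: mem_box inner_simps algebra_simps)
      then show "g (y + t *\<^sub>R e) = 0" using in_box2[of "y + t *\<^sub>R e"] by (intro supp) linarith
    qed simp
    ultimately show ?thesis by (rule has_integral_unique)
  qed
  have "((\<lambda>t. integral box2 (\<lambda>y. g (y + t *\<^sub>R e))) has_field_derivative
     integral box2 (\<lambda>y. g' (y + 0 *\<^sub>R e))) (at 0 within ?U)"
  proof (rule leibniz_rule_field_derivative)
    show "((\<lambda>t. g (y + t *\<^sub>R e)) has_real_derivative g' (y + t *\<^sub>R e)) (at t within ?U)" for y t
      by (rule has_field_derivative_at_within[OF deriv])
    show "(\<lambda>y. g (y + t *\<^sub>R e)) integrable_on box2" for t
      by (intro integrable_continuous continuous_on_compose2[OF cont(1)] continuous_intros) auto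
    show "continuous_on (?U \<times> box2) (\<lambda>(t, y). g' (y + t *\<^sub>R e))"
      unfolding case_prod_beta by (intro continuous_on_compose2[OF cont(2)] continuous_intros) auto
  qed auto
  moreover have "((\<lambda>t. integral box2 (\<lambda>y. g (y + t *\<^sub>R e))) has_field_derivative 0) (at 0)"
  proof (rule has_field_derivative_transform_within_open[where S = ?U])
    show "((\<lambda>t. integral box2 g) has_field_derivative 0) (at 0)" by simp
    show "integral box2 g = integral box2 (\<lambda>y. g (y + t *\<^sub>R e))" if "t \<in> ?U" for t
      using const[OF that] by (rule sym)
  qed auto
  moreover have "at 0 within ?U = at (0::real)" by (rule at_within_open) auto
  ultimately have "integral box2 (\<lambda>y. g' (y + 0 *\<^sub>R e)) = 0"
    by (metis DERIV_unique)
  then show ?thesis by (simp only: scaleR_zero_left add_0_right)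
qed

section \<open>The mean value identity for functions of constant Laplacian\<close>

lemma DERIV_max_0_square: "((\<lambda>s. (max 0 s)\<^sup>2) has_real_derivative 2 * max 0 s) (at s)"
proof -
  consider "s > 0" | "s < 0" | "s = 0" by linarith
  then show ?thesis
  proof cases
    case 1
    then have "((\<lambda>s. s\<^sup>2) has_real_derivative 2 * max 0 s) (at s)"
      by (auto intro!: derivative_eq_intros)
    then show ?thesis
      by (rule has_field_derivative_transform_within_open[where S = "{0<..}"]) (use 1 in auto)
  next
    case 2
    then have "((\<lambda>s. 0) has_real_derivative 2 * max 0 s) (at s)" by simp
    then show ?thesis
      by (rule has_field_derivative_transform_within_open[where S = "{..<0}"]) (use 2 in auto)
  next
    case 3
    have "((\<lambda>h. max 0 h) \<longlongrightarrow> max 0 0) (at (0::real))" by (intro tendsto_intros)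
    moreover have "\<forall>\<^sub>F h in at (0::real). max 0 h = ((max 0 (0 + h))\<^sup>2 - (max 0 0)\<^sup>2) / h"
      by (auto simp: eventually_at_filter max_def power2_eq_square)
    ultimately show ?thesis
      unfolding DERIV_def 3 by (auto elim: Lim_transform_eventually)
  qed
qed

text \<open>The property that singles out this kernel: \<open>y * bump 1 y\<close> is \<open>- 1/4\<close> times the gradient of \<open>(bump 1 y)\<^sup>2\<close>,
  which makes radial derivatives accessible to integration by parts.\<close>
lemma DERIV_bump_square:
  fixes y :: "real ^ 'n::finite"
  shows "((\<lambda>t. (bump 1 (y + t *\<^sub>R axis i 1))\<^sup>2) has_real_derivative
     - 4 * (y + t *\<^sub>R axis i 1) $ i * bump 1 (y + t *\<^sub>R axis i 1)) (at t)"
proof -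
  have norm: "(norm (y + t *\<^sub>R axis i 1))\<^sup>2 = (norm y)\<^sup>2 + 2 * t * y $ i + t\<^sup>2" for t
    unfolding power2_norm_eq_inner
    by (simp add: inner_simps inner_axis inner_axis' inner_axis_axis power2_eq_square algebra_simps)
  have "((\<lambda>t. 1 - ((norm y)\<^sup>2 + 2 * t * y $ i + t\<^sup>2)) has_real_derivative - 2 * (y $ i + t)) (at t)"
    by (auto intro!: derivative_eq_intros simp: algebra_simps)
  from DERIV_chain2[OF DERIV_max_0_square this] show ?thesis
    unfolding bump_def norm by (simp add: algebra_simps)
qed

lemma C2_imp_C1: "C2 u \<Longrightarrow> C1 u" "C2 u \<Longrightarrow> C1 (partial_deriv i u)"
  by (simp_all add: C2_def)

text \<open>The derivative in \<open>r\<close> is the integral of \<open>grad u (x + r y) \<bullet> y * bump 1 y\<close>. Since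
  \<open>y * bump 1 y\<close> is a multiple of the gradient of \<open>(bump 1 y)\<^sup>2\<close>, integrating by parts in each
  coordinate leaves \<open>r\<close> times the Laplacian against \<open>(bump 1 y)\<^sup>2\<close>.\<close>
lemma DERIV_integral_bump:
  fixes u :: "real ^ 'n::finite \<Rightarrow> real"
  assumes C2: "C2 u" and lap: "\<And>x. laplacian u x = k"
  shows "((\<lambda>r. integral box2 (\<lambda>y. u (x + r *\<^sub>R y) * bump 1 y)) has_real_derivative
     r * (k / 4 * integral box2 (\<lambda>y::real^'n. (bump 1 y)\<^sup>2))) (at r)"
proof -
  let ?D = "\<lambda>i. partial_deriv i u" and ?b = "\<lambda>y::real^'n. bump 1 y"
  note contu = C1_continuous[OF C2_imp_C1(1)[OF C2]]
    and contD = C1_continuous[OF C2_imp_C1(2)[OF C2]]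
    and contDD = continuous_partial_deriv[OF C2_imp_C1(2)[OF C2]]
  let ?F' = "\<lambda>r y. (\<Sum>i\<in>UNIV. ?D i (x + r *\<^sub>R y) * y $ i) * ?b y"
  have 1: "((\<lambda>r. integral box2 (\<lambda>y. u (x + r *\<^sub>R y) * ?b y)) has_field_derivative
      integral box2 (?F' r)) (at r within UNIV)"
  proof (rule leibniz_rule_field_derivative)
    fix r y
    have "((\<lambda>r. u (x + r *\<^sub>R y)) has_derivative (\<lambda>t. \<Sum>i\<in>UNIV. ?D i (x + r *\<^sub>R y) * (t *\<^sub>R y) $ i)) (at r)"
      by (rule has_derivative_compose[OF _ C1_has_derivative[OF C2_imp_C1(1)[OF C2]]])
        (auto intro!: derivative_eq_intros)
    then have "((\<lambda>r. u (x + r *\<^sub>R y)) has_real_derivative (\<Sum>i\<in>UNIV. ?D i (x + r *\<^sub>R y) * y $ i)) (at r)"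
      unfolding has_field_derivative_def
      by (rule has_derivative_eq_rhs) (simp add: sum_distrib_right sum_distrib_left mult_ac fun_eq_iff)
    then show "((\<lambda>r. u (x + r *\<^sub>R y) * ?b y) has_real_derivative ?F' r y) (at r within UNIV)"
      by (rule DERIV_cmult_right)
    show "(\<lambda>y. u (x + r *\<^sub>R y) * ?b y) integrable_on box2"
      by (intro integrable_continuous continuous_intros continuous_on_compose2[OF contu]) auto
    show "continuous_on (UNIV \<times> box2) (\<lambda>(r, y). ?F' r y)"
      unfolding case_prod_beta
      by (intro continuous_intros continuous_on_compose2[OF contD]) auto
  qed auto
  (* ?G i is the i-th partial derivative of (partial_deriv i u) (x + r y) * (bump 1 y)^2 in y. *)
  let ?G = "\<lambda>i y. r * partial_deriv i (?D i) (x + r *\<^sub>R y) * (?b y)\<^sup>2 - 4 * (?D i (x + r *\<^sub>R y) * y $ i * ?b y)"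
  have G0: "integral box2 (?G i) = 0" for i
  proof (rule integral_directional_derivative_eq_0[where g = "\<lambda>y. ?D i (x + r *\<^sub>R y) * (?b y)\<^sup>2" and e = "axis i 1"])
    show "continuous_on UNIV (\<lambda>y. ?D i (x + r *\<^sub>R y) * (?b y)\<^sup>2)" "continuous_on UNIV (?G i)"
      by (intro continuous_intros continuous_on_compose2[OF contD] continuous_on_compose2[OF contDD]; simp)+
    fix y :: "real^'n" and t :: real
    have "((\<lambda>t. ?D i (x + r *\<^sub>R y + (r * t) *\<^sub>R axis i 1)) has_real_derivative
        partial_deriv i (?D i) (x + r *\<^sub>R y + (r * t) *\<^sub>R axis i 1) * r) (at t)"
      by (rule DERIV_chain2[OF has_partial_deriv[OF C2_imp_C1(2)[OF C2]]])
        (auto intro!: derivative_eq_intros)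
    then have "((\<lambda>t. ?D i (x + r *\<^sub>R (y + t *\<^sub>R axis i 1))) has_real_derivative
        partial_deriv i (?D i) (x + r *\<^sub>R (y + t *\<^sub>R axis i 1)) * r) (at t)"
      by (simp add: scaleR_add_right add.assoc)
    from DERIV_mult[OF this DERIV_bump_square[of y i t]]
    show "((\<lambda>t. ?D i (x + r *\<^sub>R (y + t *\<^sub>R axis i 1)) * (?b (y + t *\<^sub>R axis i 1))\<^sup>2) has_real_derivative
        ?G i (y + t *\<^sub>R axis i 1)) (at t)"
      by (rule DERIV_cong) (simp add: algebra_simps)
  qed (auto simp: bump_eq_0 norm_axis_1)
  have int: "?G i integrable_on box2"
    "(\<lambda>y. r * k * (?b y)\<^sup>2) integrable_on box2" "(\<lambda>y. 4 * ?F' r y) integrable_on box2" for i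
    by (intro integrable_continuous continuous_intros continuous_on_compose2[OF contD] continuous_on_compose2[OF contDD]; simp)+
  have "(\<Sum>i\<in>UNIV. ?G i y) = r * k * (?b y)\<^sup>2 - 4 * ?F' r y" for y
    using lap[of "x + r *\<^sub>R y"]
    by (simp add: laplacian_def sum_subtractf flip: sum_distrib_left sum_distrib_right)
  then have "0 = integral box2 (\<lambda>y. r * k * (?b y)\<^sup>2 - 4 * ?F' r y)"
    using integral_sum[of UNIV ?G box2] int(1) G0 by simp
  also have "\<dots> = r * k * integral box2 (\<lambda>y. (?b y)\<^sup>2) - 4 * integral box2 (?F' r)"
    by (simp only: integral_diff[OF int(2,3)] integral_mult_right)
  finally have "integral box2 (?F' r) = r * (k / 4 * integral box2 (\<lambda>y. (?b y)\<^sup>2))"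
    by linarith
  with 1 show ?thesis by (simp only:)
qed

lemma quadratic_mean_value_of_laplacian:
  fixes u :: "real ^ 'n::finite \<Rightarrow> real"
  assumes C2: "C2 u" and lap: "\<And>x. laplacian u x = k"
  shows "quadratic_mean_value (k / 8 * integral box2 (\<lambda>y::real^'n. (bump 1 y)\<^sup>2)) u"
  unfolding quadratic_mean_value_def
proof (intro conjI allI impI)
  show "continuous_on UNIV u" by (rule C1_continuous[OF C2_imp_C1(1)[OF C2]])
  fix x :: "real^'n" and r :: real
  define d where "d = k / 8 * integral box2 (\<lambda>y::real^'n. (bump 1 y)\<^sup>2)"
  define F where "F r = integral box2 (\<lambda>y. u (x + r *\<^sub>R y) * bump 1 y)" for r
  have "(F has_real_derivative r * (2 * d)) (at r)" for r
    using DERIV_integral_bump[OF assms, of x r] by (simp add: F_def[abs_def] d_def)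
  then have "((\<lambda>r. F r - d * r\<^sup>2) has_real_derivative 0) (at r)" for r
    by (auto intro!: derivative_eq_intros)
  then have "F r - d * r\<^sup>2 = F 0 - d * 0\<^sup>2"
    by (intro DERIV_isconst_all) auto
  then show "F r = bump_mass TYPE(real^'n) * u x + d * r\<^sup>2"
    by (simp add: F_def bump_mass_def mult.commute)
qed

section \<open>Growth of functions satisfying the mean value identity\<close>

text \<open>Where the left side is nonzero, \<open>norm z \<le> 2 r\<close>, and there \<open>bump (4 r)\<close> is at least \<open>12 r\<^sup>2\<close>.\<close>
lemma bump_le_bump_4:
  fixes x z :: "'a::real_inner"
  assumes "norm x \<le> r" "r \<ge> 0"
  shows "bump r (z - x) \<le> bump (4 * r) z"
proof (cases "norm (z - x) \<le> r")
  case True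
  then have "norm z \<le> 2 * r" using assms norm_triangle_sub[of z x] by linarith
  then have *: "(norm z)\<^sup>2 \<le> (2 * r)\<^sup>2" by (intro power_mono) auto
  then have "r\<^sup>2 - (norm (z - x))\<^sup>2 \<le> (4 * r)\<^sup>2 - (norm z)\<^sup>2"
  proof -
    have "(2 * r)\<^sup>2 = 4 * r\<^sup>2" "(4 * r)\<^sup>2 = 16 * r\<^sup>2" by (simp_all add: power_mult_distrib)
    with * show ?thesis
      using zero_le_power2[of "norm (z - x)"] zero_le_power2[of r] by linarith
  qed
  then show ?thesis by (simp add: bump_def)
next
  case False
  then show ?thesis using bump_eq_0[OF assms(2), of "z - x"] bump_nonneg[of "4 * r" z] by simp
qed

text \<open>A Harnack comparison: as \<open>u \<ge> 0\<close>, its average around \<open>x\<close> is controlled by the average at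
  radius \<open>4 r\<close> around the origin, and the latter is known from \<open>u 0\<close>. With \<open>r = 1 + norm x\<close> the
  kernel around \<open>x\<close> is supported in the ball of radius \<open>2 r\<close> around the origin.\<close>
lemma quadratic_growth:
  fixes u :: "'a::euclidean_space \<Rightarrow> real"
  assumes mv: "quadratic_mean_value d u" and "d \<ge> 0" and pos: "\<And>x. u x \<ge> 0"
  obtains K where "\<And>x. \<bar>u x\<bar> \<le> K * (1 + norm x) ^ 2"
proof
  fix x :: 'a
  let ?c = "bump_mass TYPE('a)" and ?N = "DIM('a) + 2"
  note c = bump_mass_pos[where 'a='a]
  define r where "r = 1 + norm x"
  have r: "r \<ge> 1" "norm x \<le> r" by (auto simp: r_def)
  have "r ^ ?N * (?c * u x + d * r\<^sup>2) \<le> (4 * r) ^ ?N * (?c * u 0 + d * (4 * r)\<^sup>2)"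
  proof (rule has_integral_le)
    show "((\<lambda>z. u z * bump r (z - x)) has_integral r ^ ?N * (?c * u x + d * r\<^sup>2)) UNIV"
      using r by (intro quadratic_mean_valueD[OF mv]) auto
    show "((\<lambda>z. u z * bump (4 * r) z) has_integral (4 * r) ^ ?N * (?c * u 0 + d * (4 * r)\<^sup>2)) UNIV"
      using r quadratic_mean_valueD[OF mv, of "4 * r" 0] by simp
    show "u z * bump r (z - x) \<le> u z * bump (4 * r) z" for z
      using r by (intro mult_left_mono bump_le_bump_4 pos) auto
  qed
  then have "r ^ ?N * (?c * u x + d * r\<^sup>2) \<le> r ^ ?N * (4 ^ ?N * (?c * u 0 + 16 * d * r\<^sup>2))"
    by (simp add: power_mult_distrib algebra_simps)
  then have "?c * u x + d * r\<^sup>2 \<le> 4 ^ ?N * (?c * u 0 + 16 * d * r\<^sup>2)"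
    using r by (subst (asm) mult_le_cancel_left_pos) auto
  also have "\<dots> \<le> 4 ^ ?N * (?c * u 0 * r\<^sup>2 + 16 * d * r\<^sup>2)"
  proof -
    have "1 \<le> r\<^sup>2" using r by simp
    then have "?c * u 0 * 1 \<le> ?c * u 0 * r\<^sup>2"
      using c pos[of 0] by (intro mult_left_mono) auto
    then show ?thesis by simp
  qed
  finally have "?c * u x \<le> 4 ^ ?N * (?c * u 0 + 16 * d) * r\<^sup>2"
    using mult_nonneg_nonneg[OF \<open>d \<ge> 0\<close> zero_le_power2[of r]] by (simp add: algebra_simps)
  then show "\<bar>u x\<bar> \<le> 4 ^ ?N * (?c * u 0 + 16 * d) / ?c * (1 + norm x) ^ 2"
    using c pos[of x] by (simp add: r_def field_simps)
qed

abbreviation increment :: "'a::real_vector \<Rightarrow> ('a \<Rightarrow> real) \<Rightarrow> 'a \<Rightarrow> real"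
  where "increment h f x \<equiv> f (x + h) - f x"

lemma quadratic_mean_value_increment:
  fixes w :: "'a::euclidean_space \<Rightarrow> real"
  assumes mv: "quadratic_mean_value d w"
  shows "quadratic_mean_value 0 (increment h w)"
  unfolding quadratic_mean_value_def
proof (intro conjI allI impI)
  have w: "continuous_on UNIV w" using mv by (simp add: quadratic_mean_value_def)
  show "continuous_on UNIV (increment h w)"
    by (intro continuous_intros continuous_on_compose2[OF w]) auto
  fix x :: 'a and r :: real assume r: "r > 0"
  have int: "(\<lambda>y. w (a + r *\<^sub>R y) * bump 1 y) integrable_on box2" for a
    by (intro integrable_continuous continuous_intros continuous_on_compose2[OF w]) auto
  have mean: "integral box2 (\<lambda>y. w (a + r *\<^sub>R y) * bump 1 y) = bump_mass TYPE('a) * w a + d * r\<^sup>2" for a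
    using mv r by (simp add: quadratic_mean_value_def)
  have "integral box2 (\<lambda>y. increment h w (x + r *\<^sub>R y) * bump 1 y) =
      integral box2 (\<lambda>y. w (x + h + r *\<^sub>R y) * bump 1 y - w (x + r *\<^sub>R y) * bump 1 y)"
    by (simp add: algebra_simps)
  also have "\<dots> = bump_mass TYPE('a) * increment h w x + 0 * r\<^sup>2"
    by (subst integral_diff[OF int int]) (simp only: mean, simp add: algebra_simps)
  finally show "integral box2 (\<lambda>y. increment h w (x + r *\<^sub>R y) * bump 1 y) = \<dots>" .
qed

text \<open>A Lipschitz bound whose right side is a multiple of a larger kernel instead of the indicator of
  a ball, so that its integral is known from the mass of \<open>bump\<close> alone.\<close>
lemma bump_increment_bound:
  fixes x h z :: "'a::real_inner"
  assumes r: "norm x + norm h \<le> r" "r > 0"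
  shows "\<bar>bump r (z - (x + h)) - bump r (z - x)\<bar> \<le> norm h / r * bump (4 * r) z" 
proof (cases "norm z \<le> 2 * r")
  case True
  let ?a = "norm (z - (x + h))" and ?b = "norm (z - x)"
  have "\<bar>bump r (z - (x + h)) - bump r (z - x)\<bar> \<le> \<bar>?a\<^sup>2 - ?b\<^sup>2\<bar>"
    unfolding bump_def by linarith
  also have "\<dots> = \<bar>?a - ?b\<bar> * (?a + ?b)"
    by (simp add: power2_eq_square square_diff_square_factored abs_mult)
  also have "\<dots> \<le> norm h * (6 * r)"
  proof (rule mult_mono)
    show "\<bar>?a - ?b\<bar> \<le> norm h"
      using norm_triangle_ineq3[of "z - (x + h)" "z - x"] by simp
    show "?a + ?b \<le> 6 * r"
      using True r norm_triangle_ineq4[of z "x + h"] norm_triangle_ineq4[of z x] norm_triangle_ineq[of x h]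
        norm_ge_zero[of h]
      by linarith
  qed auto
  also have "\<dots> \<le> norm h / r * bump (4 * r) z"
  proof -
    have "(norm z)\<^sup>2 \<le> (2 * r)\<^sup>2" using True by (intro power_mono) auto
    then have "12 * r\<^sup>2 \<le> bump (4 * r) z" unfolding bump_def by (simp add: power_mult_distrib)
    moreover have "6 * r * r \<le> 12 * r\<^sup>2" by (simp add: power2_eq_square)
    ultimately have "6 * r * r \<le> bump (4 * r) z" by linarith
    then have "6 * r \<le> bump (4 * r) z / r"
      using r by (simp add: pos_le_divide_eq)
    then have "norm h * (6 * r) \<le> norm h * (bump (4 * r) z / r)"
      by (rule mult_left_mono) auto
    then show ?thesis by simp
  qed
  finally show ?thesis .
next
  case False
  have "r \<le> norm (z - (x + h))" "r \<le> norm (z - x)"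
    using False r norm_triangle_sub[of z "x + h"] norm_triangle_sub[of z x] norm_triangle_ineq[of x h] norm_ge_zero[of h]
    by linarith+
  then show ?thesis using r by (simp add: bump_eq_0 bump_nonneg)
qed

text \<open>Moving the increment from \<open>w\<close> to the kernel gains the factor \<open>norm h / r\<close>, while
  \<open>w\<close> has size at most of order \<open>r ^ j\<close> on the support.\<close>
lemma increment_bound:
  fixes w :: "'a::euclidean_space \<Rightarrow> real"
  assumes mv: "quadratic_mean_value d w" and K: "\<And>x. \<bar>w x\<bar> \<le> K * (1 + norm x) ^ j"
    and r: "1 + norm x + norm h \<le> r"
  shows "\<bar>increment h w x\<bar> \<le> 4 ^ (DIM('a) + 2) * 5 ^ j * K * norm h * r ^ j / r"
proof -
  let ?c = "bump_mass TYPE('a)" and ?N = "DIM('a) + 2"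
  note c = bump_mass_pos[where 'a='a]
  have r0: "r > 0" "norm x + norm h \<le> r" "1 \<le> r" using r norm_ge_zero[of x] norm_ge_zero[of h] by linarith+
  have K0: "0 \<le> K" using K[of 0] by simp
  define A where "A = K * (5 * r) ^ j * (norm h / r)"
  have A0: "0 \<le> A" using K0 r0 by (simp add: A_def)
  let ?g = "\<lambda>z. w z * bump r (z - (x + h)) - w z * bump r (z - x)"
  have g: "(?g has_integral r ^ ?N * (?c * increment h w x)) UNIV"
    using has_integral_diff[OF quadratic_mean_valueD[OF mv r0(1), of "x + h"] quadratic_mean_valueD[OF mv r0(1), of x]]
    by (simp add: algebra_simps)
  have B: "((\<lambda>z::'a. A * bump (4 * r) z) has_integral A * ((4 * r) ^ ?N * ?c)) UNIV"
    using has_integral_mult_right[OF quadratic_mean_valueD[OF quadratic_mean_value_1[where 'a='a], of "4 * r" 0], of A] r0 by simp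
  have "\<bar>?g z\<bar> \<le> A * bump (4 * r) z" for z
  proof (cases "norm z \<le> 4 * r")
    case True
    have "\<bar>?g z\<bar> = \<bar>w z\<bar> * \<bar>bump r (z - (x + h)) - bump r (z - x)\<bar>"
      by (simp add: right_diff_distrib flip: abs_mult)
    also have "\<dots> \<le> (K * (5 * r) ^ j) * (norm h / r * bump (4 * r) z)"
    proof (rule mult_mono[OF _ bump_increment_bound[OF r0(2,1)]])
      have "\<bar>w z\<bar> \<le> K * (1 + norm z) ^ j" by (rule K)
      also have "\<dots> \<le> K * (5 * r) ^ j" using True r0 K0 by (intro mult_left_mono power_mono) auto
      finally show "\<bar>w z\<bar> \<le> K * (5 * r) ^ j" .
    qed (use K0 r0 in auto)
    finally show ?thesis by (simp add: A_def mult.assoc)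
  next
    case False
    then have "bump (4 * r) z = 0" using r0 by (intro bump_eq_0) auto
    then have "bump r (z - (x + h)) - bump r (z - x) = 0"
      using bump_increment_bound[OF r0(2,1), of z] by simp
    then show ?thesis using A0 by (simp add: bump_nonneg flip: right_diff_distrib)
  qed
  then have le: "\<And>z::'a. norm (?g z) \<le> A * bump (4 * r) z" by simp
  have "norm (integral UNIV ?g) \<le> integral UNIV (\<lambda>z::'a. A * bump (4 * r) z)"
    by (rule integral_norm_bound_integral) (use g B le in \<open>auto simp: has_integral_iff\<close>)
  then have "\<bar>r ^ ?N * (?c * increment h w x)\<bar> \<le> A * ((4 * r) ^ ?N * ?c)"
    using g B by (simp only: integral_unique real_norm_def)
  moreover have "\<bar>r ^ ?N * (?c * increment h w x)\<bar> = r ^ ?N * ?c * \<bar>increment h w x\<bar>"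
    using c r0 by (simp add: abs_mult)
  moreover have "A * ((4 * r) ^ ?N * ?c) = r ^ ?N * ?c * (4 ^ ?N * A)"
    by (simp add: power_mult_distrib)
  ultimately have "\<bar>increment h w x\<bar> \<le> 4 ^ ?N * A"
    using c r0 by (metis mult_le_cancel_left_pos mult_pos_pos zero_less_power)
  then show ?thesis by (simp add: A_def power_mult_distrib mult_ac)
qed

text \<open>The radius \<open>(1 + norm h) * (1 + norm x)\<close> is admissible in \<open>increment_bound\<close> and comparable to
  \<open>1 + norm x\<close>.\<close>
lemma increment_growth:
  fixes w :: "'a::euclidean_space \<Rightarrow> real"
  assumes mv: "quadratic_mean_value d w" and K: "\<And>x. \<bar>w x\<bar> \<le> K * (1 + norm x) ^ Suc j"
  obtains K' where "\<And>x. \<bar>increment h w x\<bar> \<le> K' * (1 + norm x) ^ j"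
proof
  fix x :: 'a
  let ?C = "4 ^ (DIM('a) + 2) * 5 ^ Suc j * K * norm h"
  have K0: "0 \<le> K" using K[of 0] by simp
  define r where "r = (1 + norm h) * (1 + norm x)"
  have r: "r > 0" "1 + norm x + norm h \<le> r" by (auto simp: r_def algebra_simps add_pos_nonneg)
  have "\<bar>increment h w x\<bar> \<le> ?C * r ^ Suc j / r"
    by (rule increment_bound[OF mv K r(2)])
  also have "\<dots> = ?C * r ^ j"
    using r(1) by simp
  also have "\<dots> = ?C * (1 + norm h) ^ j * (1 + norm x) ^ j"
    by (simp add: r_def power_mult_distrib)
  finally show "\<bar>increment h w x\<bar> \<le> ?C * (1 + norm h) ^ j * (1 + norm x) ^ j" .
qed

text \<open>Liouville's theorem: for a bounded function the estimate of \<open>increment_bound\<close> tends to \<open>0\<close> as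
  \<open>r \<rightarrow> \<infinity>\<close>.\<close>
lemma increment_eq_0_of_bounded:
  fixes w :: "'a::euclidean_space \<Rightarrow> real"
  assumes mv: "quadratic_mean_value d w" and K: "\<And>x. \<bar>w x\<bar> \<le> K"
  shows "increment h w x = 0"
proof -
  let ?C = "4 ^ (DIM('a) + 2) * K * norm h"
  have "\<bar>increment h w x\<bar> \<le> 0"
  proof (rule tendsto_lowerbound)
    show "((\<lambda>r. ?C / r) \<longlongrightarrow> 0) at_top"
      by (rule tendsto_divide_0[OF tendsto_const filterlim_at_top_imp_at_infinity[OF filterlim_ident]])
    show "\<forall>\<^sub>F r in at_top. \<bar>increment h w x\<bar> \<le> ?C / r"
      using eventually_ge_at_top[of "1 + norm x + norm h"]
      by eventually_elim (use increment_bound[OF mv, of K 0 x h] K in auto)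
  qed simp
  then show ?thesis by simp
qed

lemma third_increment_eq_0:
  fixes u :: "'a::euclidean_space \<Rightarrow> real"
  assumes mv: "quadratic_mean_value d u" and "d \<ge> 0" and pos: "\<And>x. u x \<ge> 0"
  shows "increment l (increment k (increment h u)) x = 0"
proof -
  obtain K2 where "\<And>x. \<bar>u x\<bar> \<le> K2 * (1 + norm x) ^ Suc (Suc 0)"
    using quadratic_growth[OF assms] by (metis numeral_2_eq_2)
  from increment_growth[OF mv this]
  obtain K1 where K1: "\<And>x. \<bar>increment h u x\<bar> \<le> K1 * (1 + norm x) ^ Suc 0" by metis
  note mv1 = quadratic_mean_value_increment[OF mv, of h]
  from increment_growth[OF mv1 K1]
  obtain K0 where "\<And>x. \<bar>increment k (increment h u) x\<bar> \<le> K0 * (1 + norm x) ^ 0" by metis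
  then show ?thesis
    by (intro increment_eq_0_of_bounded[OF quadratic_mean_value_increment[OF mv1], where K=K0]) simp
qed

section \<open>Functions with vanishing third increments\<close>

text \<open>\<open>f - f'\<close> is additive, so its value at \<open>x\<close> is \<open>n\<close> times its value at \<open>x / n\<close>, which is
  \<open>o(1 / n)\<close>.\<close>
lemma additive_imp_linear_derivative:
  fixes f :: "'a::real_normed_vector \<Rightarrow> 'b::real_normed_vector"
  assumes add: "\<And>x y. f (x + y) = f x + f y"
    and deriv: "(f has_derivative f') (at 0)"
  shows "f = f'"
proof
  fix x
  have f0: "f 0 = 0" using add[of 0 0] by simp
  have mult: "f (real n *\<^sub>R y) = real n *\<^sub>R f y" for n y
    by (induction n) (simp_all add: f0 add scaleR_add_left)
  have lin: "bounded_linear f'" using deriv by (rule has_derivative_bounded_linear)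
  have "norm (f x - f' x) \<le> e * norm x" if "e > 0" for e
  proof -
    obtain d where d: "d > 0" "\<And>y. norm y < d \<Longrightarrow> norm (f y - f' y) \<le> e * norm y"
      using deriv \<open>e > 0\<close> f0 unfolding has_derivative_at_alt by auto
    obtain n where n: "norm x / d < real n" using reals_Archimedean2 by blast
    moreover have "0 \<le> norm x / d" using d by simp
    ultimately have n0: "0 < real n" by linarith
    define y where "y = x /\<^sub>R real n"
    have x: "x = real n *\<^sub>R y" using n0 by (simp add: y_def)
    have "norm y < d" using n n0 d by (simp add: y_def field_simps)
    have "f x - f' x = real n *\<^sub>R (f y - f' y)"
      unfolding x by (simp add: mult linear_scale[OF bounded_linear.linear[OF lin]] scaleR_diff_right)
    then have "norm (f x - f' x) = real n * norm (f y - f' y)" by simp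
    also have "\<dots> \<le> real n * (e * norm y)"
      using d(2)[OF \<open>norm y < d\<close>] by (intro mult_left_mono) auto
    also have "\<dots> = e * norm x" by (simp add: x)
    finally show ?thesis .
  qed
  from this[of "1 / (1 + norm x) * e" for e]
  have "norm (f x - f' x) \<le> 0 + e" if "e > 0" for e
    using that order_trans[of "norm (f x - f' x)" "e / (1 + norm x) * norm x" e]
    by (simp add: add_pos_nonneg field_simps)
  then have "norm (f x - f' x) \<le> 0" by (rule field_le_epsilon)
  then show "f x = f' x" by simp
qed

lemma linear_functional_eq_inner:
  fixes f :: "'a::euclidean_space \<Rightarrow> real"
  assumes "linear f"
  shows "f x = x \<bullet> (\<Sum>b\<in>Basis. f b *\<^sub>R b)"
proof -
  have "f x = f (\<Sum>b\<in>Basis. (x \<bullet> b) *\<^sub>R b)" by (simp add: euclidean_representation)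
  also have "\<dots> = (\<Sum>b\<in>Basis. (x \<bullet> b) * f b)"
    by (simp add: linear_sum[OF assms] linear_scale[OF assms])
  finally show ?thesis by (simp add: inner_sum_right mult.commute)
qed

text \<open>The second increment \<open>B h k\<close> does not depend on the base point. Additivity in \<open>h\<close> follows by
  splitting a step \<open>h + h'\<close> into two, and differentiability upgrades it to linearity. Subtracting
  \<open>u 0 + B x x / 2\<close> leaves an additive function, which is linear for the same reason.\<close>
lemma quadratic_of_third_increment_eq_0:
  fixes u :: "'a::euclidean_space \<Rightarrow> real"
  assumes third: "\<And>h k l x. increment l (increment k (increment h u)) x = 0"
    and diff: "\<And>x. u differentiable (at x)"
  obtains A a where "linear A" "\<And>x y. A x \<bullet> y = x \<bullet> A y" "\<And>x. u x = u 0 + a \<bullet> x + A x \<bullet> x"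
proof -
  define B where "B h k = u (h + k) - u h - u k + u 0" for h k
  have B_sym: "B h k = B k h" for h k by (simp add: B_def add.commute)
  have B_add: "B (h + h') k = B h k + B h' k" for h h' k
    using third[where h=h' and k=k and l=h and x=0] by (simp add: B_def add_ac)
  have B_lin: "linear (\<lambda>h. B h k)" for k
  proof -
    have "(\<lambda>h. B h k) differentiable (at 0)"
      unfolding B_def using differentiable_compose[of u "\<lambda>h. h + k" 0 UNIV] diff
      by (auto intro!: derivative_intros)
    then show ?thesis
      using additive_imp_linear_derivative[of "\<lambda>h. B h k", OF B_add]
      unfolding differentiable_def by (auto dest: has_derivative_linear)
  qed
  define A where "A k = (1/2) *\<^sub>R (\<Sum>b\<in>Basis. B b k *\<^sub>R b)" for k
  have A: "x \<bullet> A k = B x k / 2" for x k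
    unfolding A_def using linear_functional_eq_inner[OF B_lin, of x k] by simp
  have A_sym: "A x \<bullet> y = x \<bullet> A y" for x y
    using A[of x y] A[of y x] B_sym[of x y] by (simp add: inner_commute)
  have "linear A"
  proof
    show "A (x + y) = A x + A y" for x y
      by (rule vector_eq_rdot[THEN iffD1, rule_format])
        (simp add: inner_simps A_sym)
    show "A (c *\<^sub>R x) = c *\<^sub>R A x" for c x
      by (rule vector_eq_rdot[THEN iffD1, rule_format])
        (simp add: inner_simps A_sym)
  qed
  define g where "g x = u x - u 0 - A x \<bullet> x" for x
  have "g (x + y) = g x + g y" for x y
    using A[of x y] A_sym[of y x] A_sym[of x y]
    by (simp add: g_def linear_add[OF \<open>linear A\<close>] inner_simps B_def inner_commute[of "A y" x] field_simps)
  moreover have "g differentiable (at 0)"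
  proof -
    have "A differentiable (at 0)"
      using linear_imp_differentiable[OF \<open>linear A\<close>] by simp
    then show ?thesis unfolding g_def[abs_def] using diff
      by (intro derivative_intros differentiable_inner) auto
  qed
  ultimately have "linear g"
    using additive_imp_linear_derivative[of g]
    unfolding differentiable_def by (auto dest: has_derivative_linear)
  define a where "a = (\<Sum>b\<in>Basis. g b *\<^sub>R b)"
  have "g x = a \<bullet> x" for x
    using linear_functional_eq_inner[OF \<open>linear g\<close>, of x] by (simp add: a_def inner_commute)
  then have "u x = u 0 + a \<bullet> x + A x \<bullet> x" for x
    unfolding g_def by (metis add.commute add_diff_cancel_left' diff_add_cancel diff_diff_eq)
  then show ?thesis using that[OF \<open>linear A\<close> A_sym] by blast
qed

section \<open>Orthonormal eigenbases of self-adjoint maps\<close>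

text \<open>The spectral theorem on an invariant subspace, by induction on the dimension. A maximizer \<open>b\<close> of
  the quadratic form on the unit sphere is an eigenvector, and the orthogonal complement of \<open>b\<close>
  is again invariant.\<close>
lemma selfadjoint_diagonalizable:
  fixes f :: "'a::euclidean_space \<Rightarrow> 'a"
  assumes lin: "linear f" and sym: "\<And>x y. f x \<bullet> y = x \<bullet> f y"
    and "subspace S" "f ` S \<subseteq> S"
  shows "\<exists>B. B \<subseteq> S \<and> finite B \<and> card B = dim S \<and> pairwise orthogonal B \<and>
    (\<forall>b\<in>B. norm b = 1 \<and> (\<exists>c. f b = c *\<^sub>R b))"
  using assms(3,4)
proof (induction "dim S" arbitrary: S)
  case 0
  then show ?case by (intro exI[of _ "{}"]) auto
next
  case (Suc d)
  let ?K = "S \<inter> sphere 0 1"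
  have "S \<noteq> {0}" using Suc(2) by auto
  then obtain y where y: "y \<in> S" "y \<noteq> 0" using subspace_0[OF Suc(3)] by auto
  have "y /\<^sub>R norm y \<in> ?K" using y subspace_scale[OF Suc(3)] by simp
  then have ne: "?K \<noteq> {}" by blast
  have K: "compact ?K" by (simp add: closed_subspace[OF Suc(3)] closed_Int_compact)
  have cont: "continuous_on ?K (\<lambda>x. f x \<bullet> x)"
    by (intro continuous_intros linear_continuous_on linear_conv_bounded_linear[THEN iffD1] lin)
  obtain b where b: "b \<in> ?K" and max: "\<And>x. x \<in> ?K \<Longrightarrow> f x \<bullet> x \<le> f b \<bullet> b"
    using continuous_attains_sup[OF K ne cont] by blast
  have bS: "b \<in> S" and nb: "norm b = 1" and bb: "b \<bullet> b = 1" using b by (auto simp: norm_eq_1)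
  define c where "c = f b \<bullet> b"
  have quad: "f x \<bullet> x \<le> c * (x \<bullet> x)" if "x \<in> S" for x
  proof (cases "x = 0")
    case False
    then have "f (x /\<^sub>R norm x) \<bullet> (x /\<^sub>R norm x) \<le> c"
      unfolding c_def using that subspace_scale[OF Suc(3)] by (intro max) auto
    then have "(f x \<bullet> x) / (norm x)\<^sup>2 \<le> c"
      by (simp add: linear_scale[OF lin] power2_eq_square divide_inverse mult_ac)
    then show ?thesis using False by (simp add: divide_le_eq power2_norm_eq_inner)
  qed (simp add: linear_0[OF lin])
  have "f b = c *\<^sub>R b"
  proof -
    define z where "z = f b - c *\<^sub>R b"
    have zS: "z \<in> S" unfolding z_def using bS Suc(4) Suc(3) by (intro subspace_diff subspace_scale) auto
    have bz: "b \<bullet> z = 0" by (simp add: z_def inner_simps bb c_def inner_commute)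
    have fbz: "f b \<bullet> z = z \<bullet> z"
    proof -
      have "f b = z + c *\<^sub>R b" by (simp add: z_def)
      then have "f b \<bullet> z = (z + c *\<^sub>R b) \<bullet> z" by (rule arg_cong)
      then show ?thesis by (simp only: inner_add_left inner_scaleR_left bz)
    qed
    have zb: "z \<bullet> b = 0" using bz by (simp add: inner_commute)
    have fzb: "f z \<bullet> b = z \<bullet> z" using fbz sym[of z b] by (simp add: inner_commute)
    (* First-order optimality at b in the direction z: the term linear in t must vanish. *)
    have *: "2 * t * (z \<bullet> z) \<le> t\<^sup>2 * (c * (z \<bullet> z) - f z \<bullet> z)" for t
    proof -
      have "f (b + t *\<^sub>R z) \<bullet> (b + t *\<^sub>R z) \<le> c * ((b + t *\<^sub>R z) \<bullet> (b + t *\<^sub>R z))"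
        using bS zS Suc(3) by (intro quad subspace_add subspace_scale)
      moreover have "f (b + t *\<^sub>R z) \<bullet> (b + t *\<^sub>R z) = c + 2 * t * (z \<bullet> z) + t\<^sup>2 * (f z \<bullet> z)"
        using fbz fzb
        by (simp add: linear_add[OF lin] linear_scale[OF lin] inner_simps c_def power2_eq_square algebra_simps)
      moreover have "c * ((b + t *\<^sub>R z) \<bullet> (b + t *\<^sub>R z)) = c + t\<^sup>2 * (c * (z \<bullet> z))"
        using bz zb by (simp add: inner_simps bb power2_eq_square algebra_simps)
      ultimately show ?thesis by (simp add: algebra_simps)
    qed
    have "z \<bullet> z \<le> 0"
    proof (rule ccontr)
      assume "\<not> z \<bullet> z \<le> 0"
      then have pos: "z \<bullet> z > 0" by (simp only: not_le)
      define M where "M = c * (z \<bullet> z) - f z \<bullet> z"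
      define t where "t = (z \<bullet> z) / (\<bar>M\<bar> + 1)"
      have t: "t > 0" using pos by (simp add: t_def)
      have "2 * (z \<bullet> z) \<le> t * M"
        using *[of t] t by (simp add: M_def[symmetric] power2_eq_square)
      also have "\<dots> \<le> t * (\<bar>M\<bar> + 1)" using t by (intro mult_left_mono) auto
      also have "\<dots> = z \<bullet> z" by (simp add: t_def)
      finally show False using pos by simp
    qed
    then have "z = 0" using inner_gt_zero_iff[of z] by (metis not_le)
    then show ?thesis by (simp add: z_def)
  qed
  define S' where "S' = {x \<in> S. b \<bullet> x = 0}"
  have S': "subspace S'"
    using Suc(3) unfolding S'_def subspace_def by (auto simp: inner_simps)
  have "f ` S' \<subseteq> S'"
    using Suc(4) \<open>f b = c *\<^sub>R b\<close> by (auto simp: S'_def simp flip: sym)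
  have "dim S = Suc (dim S')"
  proof -
    have bspan: "b \<notin> span S'" using S' bb by (auto simp: span_eq_iff[THEN iffD2] S'_def)
    have "span (insert b S') = S"
    proof
      show "span (insert b S') \<subseteq> S" using bS Suc(3) by (intro span_minimal) (auto simp: S'_def)
      show "S \<subseteq> span (insert b S')"
      proof
        fix x assume "x \<in> S"
        then have "x - (b \<bullet> x) *\<^sub>R b \<in> S'"
          using bS Suc(3) by (auto simp: S'_def inner_simps bb intro!: subspace_diff subspace_scale)
        then have "x - (b \<bullet> x) *\<^sub>R b + (b \<bullet> x) *\<^sub>R b \<in> span (insert b S')"
          by (intro span_add span_scale span_base) auto
        then show "x \<in> span (insert b S')" by simp
      qed
    qed
    then have "dim S = dim (insert b S')" by (metis dim_span)
    also have "\<dots> = Suc (dim S')" using bspan by (simp add: dim_insert)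
    finally show ?thesis .
  qed
  then have "d = dim S'" using Suc(2) by simp
  from Suc(1)[OF this S' \<open>f ` S' \<subseteq> S'\<close>]
  obtain B where B: "B \<subseteq> S'" "finite B" "card B = dim S'" "pairwise orthogonal B"
    "\<forall>b\<in>B. norm b = 1 \<and> (\<exists>c. f b = c *\<^sub>R b)" by blast
  have "b \<notin> B" using B(1) bb by (auto simp: S'_def)
  show ?case
  proof (intro exI[of _ "insert b B"] conjI)
    show "insert b B \<subseteq> S" using B(1) bS by (auto simp: S'_def)
    show "card (insert b B) = dim S" using B \<open>b \<notin> B\<close> \<open>dim S = Suc (dim S')\<close> by simp
    show "pairwise orthogonal (insert b B)"
      using B(1,4) by (auto simp: pairwise_insert orthogonal_def S'_def inner_commute)
    show "\<forall>b\<in>insert b B. norm b = 1 \<and> (\<exists>c. f b = c *\<^sub>R b)"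
      using B(5) nb \<open>f b = c *\<^sub>R b\<close> by auto
  qed (use B in auto)
qed

text \<open>The eigenvectors are indexed by the coordinates themselves, since they become the rows of the
  orthogonal transformation.\<close>
lemma selfadjoint_orthonormal_eigenbasis:
  fixes A :: "real ^ 'n::finite \<Rightarrow> real ^ 'n"
  assumes "linear A" "\<And>x y. A x \<bullet> y = x \<bullet> A y"
  obtains b :: "'n \<Rightarrow> real ^ 'n" and \<mu> :: "'n \<Rightarrow> real"
  where "\<And>i j. b i \<bullet> b j = (if i = j then 1 else 0)" "\<And>j. A (b j) = \<mu> j *\<^sub>R b j"
    "\<And>x. x = (\<Sum>j\<in>UNIV. (b j \<bullet> x) *\<^sub>R b j)"
proof -
  obtain B :: "(real ^ 'n) set" where B: "finite B" "card B = CARD('n)" "pairwise orthogonal B"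
    and eig: "\<And>b. b \<in> B \<Longrightarrow> norm b = 1 \<and> (\<exists>c. A b = c *\<^sub>R b)"
    using selfadjoint_diagonalizable[OF assms, of UNIV] by auto
  obtain b where b: "bij_betw b (UNIV :: 'n set) B"
    using B by (metis finite finite_same_card_bij)
  have inB: "b j \<in> B" for j using b by (auto dest: bij_betwE)
  have "independent B"
    using B eig by (intro pairwise_orthogonal_independent) force+
  then have span: "span B = UNIV"
    using B card_ge_dim_independent[of B UNIV] by auto
  have expand: "x = (\<Sum>j\<in>UNIV. (b j \<bullet> x) *\<^sub>R b j)" for x
  proof -
    have "x = (\<Sum>v\<in>B. (x \<bullet> v) *\<^sub>R v)"
      using orthonormal_basis_expand[OF B(3) _ _ B(1), of x] eig span by simp
    also have "\<dots> = (\<Sum>j\<in>UNIV. (x \<bullet> b j) *\<^sub>R b j)"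
      by (rule sum.reindex_bij_betw[OF b, symmetric])
    finally show ?thesis by (simp add: inner_commute)
  qed
  have "\<forall>j. \<exists>c. A (b j) = c *\<^sub>R b j" using eig[OF inB] by blast
  then obtain \<mu> where "\<And>j. A (b j) = \<mu> j *\<^sub>R b j" by metis
  moreover have "b i \<bullet> b j = (if i = j then 1 else 0)" for i j
  proof (cases "i = j")
    case True
    then show ?thesis using eig[OF inB[of j]] by (simp add: norm_eq_1)
  next
    case False
    then have "b i \<noteq> b j" using b by (auto simp: bij_betw_def inj_on_def)
    then show ?thesis using B(3) inB False by (auto simp: pairwise_def orthogonal_def)
  qed
  ultimately show ?thesis using that expand by blast
qed

section \<open>Positive quadratic polynomials\<close>

lemma positive_quadratic_coeffs:
  fixes a b c :: real
  assumes pos: "\<And>t. 0 < c + b * t + a * t\<^sup>2"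
  shows "0 \<le> a" "a = 0 \<Longrightarrow> b = 0"
proof -
  have c: "c > 0" using pos[of 0] by simp
  show "0 \<le> a"
  proof (rule ccontr)
    assume "\<not> 0 \<le> a"
    then have a: "a < 0" by simp
    define t where "t = sqrt (- c / a)"
    have "t\<^sup>2 = - c / a"
      unfolding t_def using a c by (intro real_sqrt_pow2 divide_nonpos_neg) auto
    then have "a * t\<^sup>2 = - c" using a c by simp
    then show False using pos[of t] pos[of "-t"] by simp
  qed
  assume "a = 0"
  then show "b = 0" using pos[of "- c / b"] by (cases "b = 0") auto
qed

lemma laplacian_sum_squares:
  fixes b :: "'n \<Rightarrow> real ^ 'n::finite"
  assumes "\<And>j. norm (b j) = 1"
  shows "laplacian (\<lambda>x. a0 + (\<Sum>j\<in>UNIV. a j * (b j \<bullet> (x - p))\<^sup>2)) x = 2 * (\<Sum>j\<in>UNIV. a j)"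
proof -
  let ?u = "\<lambda>x. a0 + (\<Sum>j\<in>UNIV. a j * (b j \<bullet> (x - p))\<^sup>2)"
  have 1: "partial_deriv i ?u = (\<lambda>x. \<Sum>j\<in>UNIV. 2 * a j * b j $ i * (b j \<bullet> (x - p)))" for i
    unfolding partial_deriv_def
    by (rule ext, rule DERIV_imp_deriv)
      (auto intro!: derivative_eq_intros sum.cong simp: inner_simps inner_axis)
  have 2: "partial_deriv i (\<lambda>x. \<Sum>j\<in>UNIV. 2 * a j * b j $ i * (b j \<bullet> (x - p))) x = (\<Sum>j\<in>UNIV. 2 * a j * (b j $ i)\<^sup>2)" for i
    unfolding partial_deriv_def
    by (rule DERIV_imp_deriv)
      (auto intro!: derivative_eq_intros sum.cong simp: inner_simps inner_axis power2_eq_square)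
  have "(\<Sum>i\<in>UNIV. (b j $ i)\<^sup>2) = 1" for j
    using assms[of j] by (simp add: norm_vec_def L2_set_def)
  then have "(\<Sum>i\<in>UNIV. \<Sum>j\<in>UNIV. 2 * a j * (b j $ i)\<^sup>2) = (\<Sum>j\<in>UNIV. 2 * a j)"
    by (subst sum.swap) (simp flip: sum_distrib_left)
  then show ?thesis unfolding laplacian_def 1 2 by (simp add: sum_distrib_left)
qed

theorem proposition5:
  fixes u :: "real ^ 'n::finite \<Rightarrow> real"
  assumes "C2 u"
    and "\<forall>x. u x > 0"
    and "\<forall>x. laplacian u x = 1"
  shows "\<exists>(T :: real ^ 'n \<Rightarrow> real ^ 'n) p a0 (a :: 'n \<Rightarrow> real).
    orthogonal_transformation T \<and> a0 > 0 \<and> (\<forall>j. a j \<ge> 0) \<and> 2 * (\<Sum>j\<in>UNIV. a j) = 1 \<and>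
    (\<forall>x. u x = a0 + (\<Sum>j\<in>UNIV. a j * (T (x - p) $ j)\<^sup>2))"
proof -
  have pos: "u x > 0" and lap: "laplacian u x = 1" for x using assms by auto
  have "0 \<le> 1 / 8 * integral box2 (\<lambda>y::real^'n. (bump 1 y)\<^sup>2)"
    by (auto intro!: integral_nonneg integrable_continuous continuous_intros)
  from third_increment_eq_0[OF quadratic_mean_value_of_laplacian[OF assms(1) lap] this less_imp_le[OF pos]]
  have third: "increment l (increment k (increment h u)) x = 0" for h k l x .
  have "u differentiable (at x)" for x
    using C1_has_derivative[OF C2_imp_C1(1)[OF assms(1)]] by (auto simp: differentiable_def)
  then obtain A q where A: "linear A" "\<And>x y. A x \<bullet> y = x \<bullet> A y"
    and u: "\<And>x. u x = u 0 + q \<bullet> x + A x \<bullet> x"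
    using quadratic_of_third_increment_eq_0[OF third] by blast
  obtain b :: "'n \<Rightarrow> real ^ 'n" and \<mu> :: "'n \<Rightarrow> real"
    where orth: "\<And>i j. b i \<bullet> b j = (if i = j then 1 else 0)"
    and eig: "\<And>j. A (b j) = \<mu> j *\<^sub>R b j"
    and expand: "\<And>x. x = (\<Sum>j\<in>UNIV. (b j \<bullet> x) *\<^sub>R b j)"
    using selfadjoint_orthonormal_eigenbasis[OF A] by blast
  have inner: "x \<bullet> y = (\<Sum>j\<in>UNIV. (b j \<bullet> x) * (b j \<bullet> y))" for x y
    by (subst (1) expand[of x]) (simp add: inner_sum_left)
  define c where "c j = b j \<bullet> q" for j
  have Ab: "b j \<bullet> A x = \<mu> j * (b j \<bullet> x)" for j x
    using A(2)[of "b j" x] eig[of j] by simp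
  have u_diag: "u x = u 0 + (\<Sum>j\<in>UNIV. c j * (b j \<bullet> x) + \<mu> j * (b j \<bullet> x)\<^sup>2)" for x
    by (subst u) (simp add: inner[of q x] inner[of "A x" x] Ab c_def sum.distrib power2_eq_square mult.assoc)
  have line: "0 < u 0 + c j * t + \<mu> j * t\<^sup>2" for j t
    using pos[of "t *\<^sub>R b j"] u[of "t *\<^sub>R b j"]
    by (simp add: linear_scale[OF A(1)] eig orth c_def inner_commute[of q] power2_eq_square algebra_simps)
  have mu: "0 \<le> \<mu> j" "\<mu> j = 0 \<Longrightarrow> c j = 0" for j
    using positive_quadratic_coeffs[OF line[of j]] by blast+
  define T where "T x = (\<chi> j. b j \<bullet> x)" for x
  (* When the eigenvalue is 0, division by zero gives coefficient 0, and c j = 0 as well, so the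
     completed square below remains valid. *)
  define p where "p = (\<Sum>j\<in>UNIV. (- c j / (2 * \<mu> j)) *\<^sub>R b j)"
  define a0 where "a0 = u 0 - (\<Sum>j\<in>UNIV. (c j)\<^sup>2 / (4 * \<mu> j))"
  have bp: "b j \<bullet> p = - c j / (2 * \<mu> j)" for j
    by (simp add: p_def inner_sum_right orth if_distrib cong: if_cong)
  have square: "c j * t + \<mu> j * t\<^sup>2 = \<mu> j * (t + c j / (2 * \<mu> j))\<^sup>2 - (c j)\<^sup>2 / (4 * \<mu> j)" for j t
    using mu(2)[of j] by (cases "\<mu> j = 0") (simp_all add: field_simps power2_eq_square)
  have u_sq: "u x = a0 + (\<Sum>j\<in>UNIV. \<mu> j * (b j \<bullet> (x - p))\<^sup>2)" for x
    unfolding u_diag[of x] a0_def inner_diff_right bp by (simp add: square sum_subtractf)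
  show ?thesis
  proof (intro exI conjI allI)
    show "orthogonal_transformation T"
      unfolding orthogonal_transformation_def
    proof
      show "linear T" by (auto intro!: linearI simp: T_def vec_eq_iff inner_simps)
      have "T v \<bullet> T w = (\<Sum>j\<in>UNIV. (b j \<bullet> v) * (b j \<bullet> w))" for v w
        by (subst inner_vec_def) (simp add: T_def)
      then show "\<forall>v w. T v \<bullet> T w = v \<bullet> w"
        by (simp only: inner[symmetric] simp_thms)
    qed
    show "0 < a0" using u_sq[of p] pos[of p] by simp
    show "0 \<le> \<mu> j" for j by (rule mu)
    have "laplacian (\<lambda>x. a0 + (\<Sum>j\<in>UNIV. \<mu> j * (b j \<bullet> (x - p))\<^sup>2)) 0 = 2 * (\<Sum>j\<in>UNIV. \<mu> j)"
      by (rule laplacian_sum_squares) (simp add: norm_eq_1 orth)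
    moreover have "u = (\<lambda>x. a0 + (\<Sum>j\<in>UNIV. \<mu> j * (b j \<bullet> (x - p))\<^sup>2))" using u_sq by (rule ext)
    ultimately show "2 * (\<Sum>j\<in>UNIV. \<mu> j) = 1" using lap[of 0] by simp
    show "u x = a0 + (\<Sum>j\<in>UNIV. \<mu> j * (T (x - p) $ j)\<^sup>2)" for x
      using u_sq[of x] by (simp add: T_def)
  qed
qed

end
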